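(* Let $k$ and $K$ be two concentric circles in the plane $\mathbb{R}^2$ with radii $r$ and $R$ respectively, where $0<r<R$. Let $D_1,\dots,D_m$ be finitely many angular domains with angles $\alpha_1,\dots,\alpha_m$, whose vertices all lie within $K$ (that is, in the closed disc bounded by $K$), and assume that the closed disc bounded by $k$ is covered by them, i.e. is contained in $\bigcup_{i=1}^m D_i$. Then for every point $P\in K$, the sum $\sum_{i=1}^m\alpha_i$ is greater than or equal to the view angle of $k$ from $P$.
   Context: An angular domain in $\mathbb{R}^2$ is a closed convex set $D$ bounded by two halflines with a common endpoint. This common endpoint is called the vertex of $D$, and the angle of $D$ is the angle (in radians) enclosed by the two bounding halflines; by convexity it is at most $\pi$. The view angle of a circle $k$ from a point $P$ outside it is the angle, at $P$, between the two tangent halflines from $P$ to $k$, i.e. the angle of the smallest angular domain with vertex $P$ containing $k$. For a circle $k$ of radius $r$ and a point $P$ at distance $R>r$ from its center, it equals $2\arcsin(r/R)$. *)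

theory Defs
  imports "HOL-Analysis.Analysis"
begin

definition halfline :: "real^2 \<Rightarrow> real^2 \<Rightarrow> (real^2) set" where
  "halfline A u = {A + t *\<^sub>R u | t. 0 \<le> t}"

definition enclosed_angle :: "real^2 \<Rightarrow> real^2 \<Rightarrow> real" where
  "enclosed_angle u v = arccos (u \<bullet> v / (norm u * norm v))"

text \<open>
  The vertex and the angle are arguments of a relation rather than functions of the domain,
  because a closed half-plane is an angular domain (of angle \<open>pi\<close>) with every point of its
  boundary line as a vertex. The last conjunct rules out the full line, which is also closed and
  convex with two opposite halflines as its frontier. The degenerate domain of angle \<open>0\<close>, a single
  halfline, is admitted.
\<close>

definition angular_domain :: "real^2 \<Rightarrow> real \<Rightarrow> (real^2) set \<Rightarrow> bool" where
  "angular_domain A \<alpha> D \<longleftrightarrow>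
     (\<exists>u v. u \<noteq> 0 \<and> v \<noteq> 0 \<and> \<alpha> = enclosed_angle u v \<and>
            closed D \<and> convex D \<and> frontier D = halfline A u \<union> halfline A v \<and>
            (interior D = {} \<longrightarrow> halfline A u = halfline A v))"

definition tangent_halfline :: "real^2 \<Rightarrow> real \<Rightarrow> real^2 \<Rightarrow> real^2 \<Rightarrow> bool" where
  "tangent_halfline c r P u \<longleftrightarrow>
     u \<noteq> 0 \<and> (\<exists>Q \<in> halfline P u \<inter> sphere c r. (Q - c) \<bullet> u = 0)"

text \<open>
  Meaningful for \<open>0 < r < dist P c\<close>, where there are exactly two tangent halflines;
  see \<open>view_angle_eq\<close> below.
\<close>

definition view_angle :: "real^2 \<Rightarrow> real \<Rightarrow> real^2 \<Rightarrow> real" where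
  "view_angle c r P =
     (THE \<theta>. \<exists>u v. tangent_halfline c r P u \<and> tangent_halfline c r P v \<and>
                  halfline P u \<noteq> halfline P v \<and> \<theta> = enclosed_angle u v)"

lemma halfline_scale: "t > 0 \<Longrightarrow> halfline P (t *\<^sub>R u) = halfline P u"
proof -
  assume t: "t > 0"
  have "halfline P (t *\<^sub>R u) \<subseteq> halfline P u"
  proof
    fix x assume "x \<in> halfline P (t *\<^sub>R u)"
    then obtain s where s: "s \<ge> 0" "x = P + s *\<^sub>R (t *\<^sub>R u)" unfolding halfline_def by auto
    then have "x = P + (s * t) *\<^sub>R u" "s * t \<ge> 0" using t by auto
    then show "x \<in> halfline P u" unfolding halfline_def by blast
  qed
  moreover have "halfline P u \<subseteq> halfline P (t *\<^sub>R u)"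
  proof
    fix x assume "x \<in> halfline P u"
    then obtain s where s: "s \<ge> 0" "x = P + s *\<^sub>R u" unfolding halfline_def by auto
    then have "x = P + (s / t) *\<^sub>R (t *\<^sub>R u)" "s / t \<ge> 0" using t by auto
    then show "x \<in> halfline P (t *\<^sub>R u)" unfolding halfline_def by blast
  qed
  ultimately show ?thesis by blast
qed

lemma enclosed_angle_scale:
  "s > 0 \<Longrightarrow> t > 0 \<Longrightarrow> enclosed_angle (s *\<^sub>R u) (t *\<^sub>R v) = enclosed_angle u v"
  by (simp add: enclosed_angle_def)

lemma tangent_halflineE:
  assumes "tangent_halfline c r P u" "r < dist P c"
  obtains t a where "t > 0" "t *\<^sub>R u = a - (P - c)" "a \<bullet> a = r\<^sup>2" "a \<bullet> (P - c) = r\<^sup>2"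
proof -
  from assms obtain Q t where Q: "t \<ge> 0" "Q = P + t *\<^sub>R u" "norm (Q - c) = r" "(Q - c) \<bullet> u = 0"
    by (auto simp: tangent_halfline_def halfline_def dist_norm norm_minus_commute)
  have "t \<noteq> 0" using Q assms(2) by (auto simp: dist_norm)
  moreover have eq: "t *\<^sub>R u = (Q - c) - (P - c)" using Q by simp
  moreover have a: "(Q - c) \<bullet> (Q - c) = r\<^sup>2" using Q(3) by (metis power2_norm_eq_inner)
  moreover have "(Q - c) \<bullet> (P - c) = r\<^sup>2"
  proof -
    have "(Q - c) \<bullet> (t *\<^sub>R u) = 0" using Q(4) by simp
    then show ?thesis using a unfolding eq by (simp add: inner_diff_right)
  qed
  ultimately show ?thesis using that[of t "Q - c"] Q(1) by simp
qed

lemma tangent_halflineI: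
  assumes "r \<ge> 0" "a \<bullet> a = r\<^sup>2" "a \<bullet> (P - c) = r\<^sup>2" "a \<noteq> P - c"
  shows "tangent_halfline c r P (a - (P - c))"
proof -
  have "c + a \<in> halfline P (a - (P - c))"
    unfolding halfline_def by (auto intro!: exI[of _ 1])
  moreover have "norm a = r" using assms by (simp add: norm_eq_sqrt_inner)
  moreover have "a \<bullet> (a - (P - c)) = 0" using assms by (simp add: inner_diff_right)
  ultimately show ?thesis
    using assms(4) unfolding tangent_halfline_def by (intro conjI bexI[of _ "c + a"]) (auto simp: dist_norm)
qed

lemma tangent_angle:
  fixes a b w :: "real^2"
  assumes r: "0 < r" "r < norm w"
    and a: "a \<bullet> a = r\<^sup>2" "a \<bullet> w = r\<^sup>2" and b: "b \<bullet> b = r\<^sup>2" "b \<bullet> w = r\<^sup>2" and "a \<noteq> b"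
  shows "enclosed_angle (a - w) (b - w) = 2 * arcsin (r / norm w)"
proof -
  define d where "d = norm w"
  have d: "w \<bullet> w = d\<^sup>2" unfolding d_def by (simp add: power2_norm_eq_inner)
  have d0: "d > 0" "r < d" using r by (auto simp: d_def)
  have rd: "d\<^sup>2 - r\<^sup>2 > 0" using d0 r by (simp add: power_strict_mono)
  define A where "A = a$1 * w$2 - a$2 * w$1"
  define B where "B = b$1 * w$2 - b$2 * w$1"
  note ids = inner_vec_def sum_2
  have A2: "A\<^sup>2 = r\<^sup>2 * d\<^sup>2 - (r\<^sup>2)\<^sup>2"
  proof -
    have "A\<^sup>2 = (a \<bullet> a) * (w \<bullet> w) - (a \<bullet> w)\<^sup>2" unfolding A_def ids inner_real_def by algebra
    then show ?thesis using a d by simp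
  qed
  have B2: "B\<^sup>2 = r\<^sup>2 * d\<^sup>2 - (r\<^sup>2)\<^sup>2"
  proof -
    have "B\<^sup>2 = (b \<bullet> b) * (w \<bullet> w) - (b \<bullet> w)\<^sup>2" unfolding B_def ids inner_real_def by algebra
    then show ?thesis using b d by simp
  qed
  have "A \<noteq> B"
  proof
    assume "A = B"
    have e1: "d\<^sup>2 * a$1 = (a \<bullet> w) * w$1 + A * w$2" "d\<^sup>2 * a$2 = (a \<bullet> w) * w$2 - A * w$1"
      unfolding d[symmetric] A_def ids inner_real_def by algebra+
    have e2: "d\<^sup>2 * b$1 = (b \<bullet> w) * w$1 + B * w$2" "d\<^sup>2 * b$2 = (b \<bullet> w) * w$2 - B * w$1"
      unfolding d[symmetric] B_def ids inner_real_def by algebra+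
    have "d\<^sup>2 * a$1 = d\<^sup>2 * b$1" "d\<^sup>2 * a$2 = d\<^sup>2 * b$2" using e1 e2 a b \<open>A = B\<close> by auto
    then have "a$1 = b$1" "a$2 = b$2" using d0 by auto
    then have "a = b" by (simp add: vec_eq_iff forall_2)
    then show False using \<open>a \<noteq> b\<close> by simp
  qed
  then have AB: "A = - B" using A2 B2 by (metis power2_eq_iff)
  have "(a \<bullet> b) * d\<^sup>2 = (a \<bullet> w) * (b \<bullet> w) + A * B"
    unfolding d[symmetric] A_def B_def ids inner_real_def by algebra
  also have "A * B = - (r\<^sup>2 * d\<^sup>2 - (r\<^sup>2)\<^sup>2)" using AB B2 by (simp add: power2_eq_square)
  finally have ab: "(a \<bullet> b) * d\<^sup>2 = 2 * (r\<^sup>2)\<^sup>2 - r\<^sup>2 * d\<^sup>2"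
    using a b by (simp add: power2_eq_square)
  have na: "norm (a - w) = sqrt (d\<^sup>2 - r\<^sup>2)"
    using a d by (simp add: norm_eq_sqrt_inner inner_diff_left inner_diff_right inner_commute)
  have nb: "norm (b - w) = sqrt (d\<^sup>2 - r\<^sup>2)"
    using b d by (simp add: norm_eq_sqrt_inner inner_diff_left inner_diff_right inner_commute)
  have inn: "(a - w) \<bullet> (b - w) = a \<bullet> b - 2 * r\<^sup>2 + d\<^sup>2"
    using a b d by (simp add: inner_diff_left inner_diff_right inner_commute)
  have "(a \<bullet> b - 2 * r\<^sup>2 + d\<^sup>2) * d\<^sup>2 = (1 - 2 * (r / d)\<^sup>2) * (d\<^sup>2 - r\<^sup>2) * d\<^sup>2"
  proof -
    have "(r / d)\<^sup>2 * d\<^sup>2 = r\<^sup>2" using d0 by (simp add: power_divide)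
    then show ?thesis using ab by algebra
  qed
  then have "a \<bullet> b - 2 * r\<^sup>2 + d\<^sup>2 = (1 - 2 * (r / d)\<^sup>2) * (d\<^sup>2 - r\<^sup>2)" using d0 by simp
  moreover have "norm (a - w) * norm (b - w) = d\<^sup>2 - r\<^sup>2" using na nb rd by simp
  ultimately have "(a - w) \<bullet> (b - w) / (norm (a - w) * norm (b - w)) = 1 - 2 * (r / d)\<^sup>2"
    using inn rd by simp
  also have "\<dots> = cos (2 * arcsin (r / d))"
  proof -
    have "0 \<le> r / d" "r / d \<le> 1" using r(1) d0 by auto
    then have "sin (arcsin (r / d)) = r / d" by (intro sin_arcsin) linarith+
    then show ?thesis by (simp add: cos_double_sin)
  qed
  finally have "enclosed_angle (a - w) (b - w) = arccos (cos (2 * arcsin (r / d)))"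
    by (simp add: enclosed_angle_def)
  moreover have "0 \<le> arcsin (r / d) \<and> arcsin (r / d) \<le> pi / 2"
  proof -
    have "0 \<le> r / d" "r / d \<le> 1" using r(1) d0 by auto
    then show ?thesis using arcsin_nonneg arcsin_bounded[of "r / d"] by auto
  qed
  ultimately show ?thesis by (simp add: arccos_cos d_def)
qed

lemma view_angle_eq:
  assumes "0 < r" "r < dist P c"
  shows "view_angle c r P = 2 * arcsin (r / dist P c)"
proof -
  define w where "w = P - c"
  have r: "0 < r" "r < norm w" using assms by (auto simp: w_def dist_norm)
  have d: "w \<bullet> w = (norm w)\<^sup>2" by (simp add: power2_norm_eq_inner)
  have rd: "r\<^sup>2 < (norm w)\<^sup>2" using r by (simp add: power_strict_mono)
  have uniq: "enclosed_angle u v = 2 * arcsin (r / dist P c)"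
    if u: "tangent_halfline c r P u" and v: "tangent_halfline c r P v"
      and ne: "halfline P u \<noteq> halfline P v" for u v
  proof -
    obtain s a where a: "s > 0" "s *\<^sub>R u = a - w" "a \<bullet> a = r\<^sup>2" "a \<bullet> w = r\<^sup>2"
      using tangent_halflineE[OF u assms(2)] unfolding w_def by metis
    obtain t b where b: "t > 0" "t *\<^sub>R v = b - w" "b \<bullet> b = r\<^sup>2" "b \<bullet> w = r\<^sup>2"
      using tangent_halflineE[OF v assms(2)] unfolding w_def by metis
    have "a \<noteq> b" using a b ne halfline_scale by metis
    then have "enclosed_angle (a - w) (b - w) = 2 * arcsin (r / norm w)"
      using tangent_angle r a b by blast
    then show ?thesis
      using enclosed_angle_scale[OF a(1) b(1), of u v] a b by (simp add: w_def dist_norm)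
  qed
  have "\<exists>u v. tangent_halfline c r P u \<and> tangent_halfline c r P v \<and> halfline P u \<noteq> halfline P v"
  proof -
    define p where "p = r\<^sup>2 / (norm w)\<^sup>2"
    define q where "q = r * sqrt ((norm w)\<^sup>2 - r\<^sup>2) / (norm w)\<^sup>2"
    define z :: "real^2" where "z = vector [- w$2, w$1]"
    have z: "z \<bullet> w = 0" "w \<bullet> z = 0" "z \<bullet> z = (norm w)\<^sup>2"
      unfolding d[symmetric] z_def by (auto simp: inner_vec_def sum_2)
    have n0: "(norm w)\<^sup>2 > 0" "norm w > 0" using r by auto
    have q: "q > 0" unfolding q_def using r rd n0 by simp
    have pw: "p * (norm w)\<^sup>2 = r\<^sup>2" using n0 by (simp add: p_def)
    have qw: "q\<^sup>2 * (norm w)\<^sup>2 = r\<^sup>2 - p * r\<^sup>2"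
    proof -
      have "q\<^sup>2 = r\<^sup>2 * ((norm w)\<^sup>2 - r\<^sup>2) / ((norm w)\<^sup>2)\<^sup>2"
        using rd by (simp add: q_def power_mult_distrib power_divide)
      then show ?thesis using n0 by (simp add: p_def field_simps power2_eq_square)
    qed
    define a where "a = p *\<^sub>R w + q *\<^sub>R z"
    define b where "b = p *\<^sub>R w - q *\<^sub>R z"
    have sq: "p * (p * (norm w)\<^sup>2) + q * (q * (norm w)\<^sup>2) = r\<^sup>2"
      using pw qw by (simp add: power2_eq_square algebra_simps)
    have a: "a \<bullet> a = r\<^sup>2" "a \<bullet> w = r\<^sup>2"
      using sq pw by (auto simp: a_def inner_add_left inner_add_right z d)
    have b: "b \<bullet> b = r\<^sup>2" "b \<bullet> w = r\<^sup>2"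
      using sq pw by (auto simp: b_def inner_diff_left inner_diff_right z d)
    have "a \<noteq> w" "b \<noteq> w" using a b rd d by auto
    then have T: "tangent_halfline c r P (a - w)" "tangent_halfline c r P (b - w)"
      unfolding w_def using a b r by (auto intro!: tangent_halflineI simp: w_def)
    have "halfline P (a - w) \<noteq> halfline P (b - w)"
    proof
      assume "halfline P (a - w) = halfline P (b - w)"
      moreover have "P + (a - w) \<in> halfline P (a - w)"
        unfolding halfline_def by (auto intro!: exI[of _ 1])
      ultimately obtain t where t: "t \<ge> 0" "a - w = t *\<^sub>R (b - w)"
        unfolding halfline_def by auto
      have "(a - w) \<bullet> z = q * (norm w)\<^sup>2" "(b - w) \<bullet> z = - (q * (norm w)\<^sup>2)"
        by (simp_all add: a_def b_def inner_diff_left inner_add_left z)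
      then have "q * (norm w)\<^sup>2 = - t * (q * (norm w)\<^sup>2)" using t by simp
      moreover have "q * (norm w)\<^sup>2 > 0" using q n0 by simp
      ultimately show False using t by (metis mult_nonneg_nonneg neg_le_0_iff_le less_le_not_le mult_minus_left less_eq_real_def)
    qed
    then show ?thesis using T by blast
  qed
  then show ?thesis
    unfolding view_angle_def by (intro the_equality) (metis uniq)+
qed

end

theory Submission
  imports Defs
begin

text \<open>
  The closed disc \<open>cball c r\<close> carries the mass distribution with density
  \<open>f p = sqrt (R\<^sup>2 - r\<^sup>2) / (pi * (R\<^sup>2 - \<bar>p - c\<bar>\<^sup>2) * sqrt (r\<^sup>2 - \<bar>p - c\<bar>\<^sup>2))\<close>, which is tuned so
  that an angular domain of angle \<open>\<alpha>\<close> with its vertex in \<open>cball c R\<close> has mass at most \<open>\<alpha>\<close>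
  (\<open>nn_integral_disc_density_fan_le\<close>), while the disc has mass at least \<open>2 * arcsin (r / R)\<close>, the
  view angle (\<open>nn_integral_disc_density_ge\<close>). Domains that cover the disc have together at least its
  mass, so their angles add up to at least the view angle. This is the analogue of the proof of the
  plank theorem for the disc that uses Archimedes' density \<open>1 / sqrt (r\<^sup>2 - \<bar>p - c\<bar>\<^sup>2)\<close>, for which the
  mass of a strip across the disc is proportional to its width.

  Both mass estimates come from one radial integral. In polar coordinates around the vertex \<open>A\<close> the
  mass of a domain is the integral over its directions \<open>v\<close> of the radial integral of
  \<open>\<rho> * f (A + \<rho> * v)\<close>, so it suffices to bound the latter by \<open>1\<close>. Let \<open>t\<close> measure the position on the
  line through \<open>A\<close> in direction \<open>v\<close>, starting from the foot of the perpendicular from \<open>c\<close>; let the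
  line meet the two discs in the chords \<open>\<bar>t\<bar> \<le> a\<close> and \<open>\<bar>t\<bar> \<le> b\<close>. Then \<open>b\<^sup>2 - a\<^sup>2 = R\<^sup>2 - r\<^sup>2\<close> whatever
  the line is, and the density on it is
  \<open>sqrt (b\<^sup>2 - a\<^sup>2) / (pi * (b - t) * (b + t) * sqrt (a\<^sup>2 - t\<^sup>2))\<close>. Since \<open>A\<close> lies in the large disc, the
  distance \<open>\<rho>\<close> from \<open>A\<close> is at most the distance \<open>b + t\<close> from the point where the line enters that disc,
  and the factor \<open>b + t\<close> cancels: the radial integral is at most that of
  \<open>sqrt (b\<^sup>2 - a\<^sup>2) / (pi * (b - t) * sqrt (a\<^sup>2 - t\<^sup>2))\<close> over \<open>\<bar>t\<bar> \<le> a\<close>, which is \<open>1\<close>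
  (\<open>nn_integral_arcsine_kernel\<close>). For \<open>A\<close> on the large circle and a direction that hits the open
  small disc, \<open>\<rho> = b + t\<close> and the radial integral is exactly \<open>1\<close>; integrating over the directions
  within the view angle gives the mass of the disc.

  Polar coordinates are replaced by slopes: a domain of angle at most \<open>pi\<close> lies in a half-plane
  bounded by a line through its vertex, its points off that line are \<open>A + x * (w + m * w')\<close> with \<open>x > 0\<close>, and
  the angular element is \<open>dm / (1 + m\<^sup>2)\<close> (\<open>nn_integral_fan_coordinates\<close>).
\<close>

section \<open>A density on the disc\<close>

definition disc_density :: "'a::real_normed_vector \<Rightarrow> real \<Rightarrow> real \<Rightarrow> 'a \<Rightarrow> real" where
  "disc_density c r R p =
     (if norm (p - c) < r
      then sqrt (R\<^sup>2 - r\<^sup>2) / (pi * ((R\<^sup>2 - (norm (p - c))\<^sup>2) * sqrt (r\<^sup>2 - (norm (p - c))\<^sup>2)))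
      else 0)"

lemma borel_measurable_disc_density [measurable]:
  "disc_density c r R \<in> borel_measurable (borel :: 'a::euclidean_space measure)"
  unfolding disc_density_def by measurable

lemma disc_density_nonneg:
  assumes "0 < r" "r < R"
  shows "0 \<le> disc_density c r R p"
proof (cases "norm (p - c) < r")
  case True
  then have "(norm (p - c))\<^sup>2 < r\<^sup>2" "r\<^sup>2 < R\<^sup>2" using assms by (auto intro: power_strict_mono)
  then show ?thesis by (simp add: disc_density_def)
qed (simp add: disc_density_def)

text \<open>
  With \<open>c = sqrt (b\<^sup>2 - a\<^sup>2)\<close> and the fractional linear map \<open>w t = (b * t - a\<^sup>2) / (a * (b - t))\<close> of
  \<open>{-a..a}\<close> onto \<open>{-1..1}\<close>, the function \<open>arcsin (w t) / c\<close> is an antiderivative. It is continuous up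
  to the end points, where the integrand blows up.
\<close>

lemma nn_integral_arcsine_kernel:
  assumes a: "0 < a" and b: "a < b"
  shows "(\<integral>\<^sup>+ t. ennreal (1 / ((b - t) * sqrt (a\<^sup>2 - t\<^sup>2))) * indicator {-a..a} t \<partial>lborel)
         = ennreal (pi / sqrt (b\<^sup>2 - a\<^sup>2))"
proof -
  define c where "c = sqrt (b\<^sup>2 - a\<^sup>2)"
  define w where "w t = (b * t - a\<^sup>2) / (a * (b - t))" for t
  have "b\<^sup>2 - a\<^sup>2 > 0" using a b by (simp add: power_strict_mono)
  then have c: "c > 0" "c\<^sup>2 = b\<^sup>2 - a\<^sup>2" by (auto simp: c_def)
  have w_ids: "1 - (w t)\<^sup>2 = c\<^sup>2 * (a\<^sup>2 - t\<^sup>2) / (a * (b - t))\<^sup>2" if "t \<le> a" for t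
  proof -
    have "(a * (b - t))\<^sup>2 \<noteq> 0" using a b that by simp
    moreover have "(a * (b - t))\<^sup>2 - (b * t - a\<^sup>2)\<^sup>2 = (b\<^sup>2 - a\<^sup>2) * (a\<^sup>2 - t\<^sup>2)"
      by algebra
    ultimately show ?thesis
      unfolding w_def c(2) power_divide by (metis diff_divide_distrib divide_self)
  qed
  have w_le: "\<bar>w t\<bar> \<le> 1" if "t \<in> {-a..a}" for t
  proof -
    have "t\<^sup>2 \<le> a\<^sup>2" using that by (auto simp: abs_le_square_iff[symmetric] abs_le_iff)
    then have "0 \<le> 1 - (w t)\<^sup>2" using w_ids[of t] that by simp
    then show ?thesis by (simp add: abs_square_le_1)
  qed
  have deriv: "((\<lambda>t. arcsin (w t) / c) has_real_derivative 1 / ((b - t) * sqrt (a\<^sup>2 - t\<^sup>2))) (at t)"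
    if t: "t \<in> {-a<..<a}" for t
  proof -
    have t2: "a\<^sup>2 - t\<^sup>2 > 0" using t abs_square_less_1[of "t / a"] a by (auto simp: power_divide field_simps abs_less_iff)
    have bt: "b - t > 0" using t b by simp
    have "0 < c\<^sup>2 * (a\<^sup>2 - t\<^sup>2) / (a * (b - t))\<^sup>2"
      using c(1) a t2 bt by (intro divide_pos_pos mult_pos_pos zero_less_power)
    then have pos: "0 < 1 - (w t)\<^sup>2" using w_ids[of t] t by simp
    then have "\<bar>w t\<bar> < 1" by (simp add: abs_square_less_1)
    then have w1: "-1 < w t" "w t < 1" by auto
    have "(w has_real_derivative (b * (a * (b - t)) - (b * t - a\<^sup>2) * - a) / (a * (b - t))\<^sup>2) (at t)"
      unfolding w_def using a bt
      by (auto intro!: derivative_eq_intros simp: power2_eq_square)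
    also have "b * (a * (b - t)) - (b * t - a\<^sup>2) * - a = a * c\<^sup>2"
      unfolding c(2) by algebra
    also have "a * c\<^sup>2 / (a * (b - t))\<^sup>2 = c\<^sup>2 / (a * (b - t)\<^sup>2)"
      using a by (simp add: power_mult_distrib power2_eq_square)
    finally have dw: "(w has_real_derivative c\<^sup>2 / (a * (b - t)\<^sup>2)) (at t)" .
    have sq: "sqrt (1 - (w t)\<^sup>2) = c * sqrt (a\<^sup>2 - t\<^sup>2) / (a * (b - t))"
      using w_ids[of t] t c(1) a bt by (simp add: real_sqrt_divide real_sqrt_mult)
    have "((\<lambda>t. arcsin (w t) / c) has_real_derivative
            inverse (sqrt (1 - (w t)\<^sup>2)) * (c\<^sup>2 / (a * (b - t)\<^sup>2)) / c) (at t)"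
      by (intro DERIV_cdivide DERIV_chain2[OF DERIV_arcsin dw] w1)
    also have "inverse (sqrt (1 - (w t)\<^sup>2)) * (c\<^sup>2 / (a * (b - t)\<^sup>2)) / c = 1 / ((b - t) * sqrt (a\<^sup>2 - t\<^sup>2))"
    proof -
      have "inverse (c * S / (a * B)) * (c\<^sup>2 / (a * B\<^sup>2)) / c = 1 / (B * S)" if "0 < S" "0 < B" for S B
        using that c(1) a by (simp add: divide_simps power2_eq_square)
      then show ?thesis unfolding sq using t2 bt by simp
    qed
    finally show ?thesis .
  qed
  have cont: "continuous_on {-a..a} (\<lambda>t. arcsin (w t) / c)"
  proof (intro continuous_intros continuous_on_arcsin)
    show "continuous_on {-a..a} w" unfolding w_def using a b by (auto intro!: continuous_intros)
  qed (use w_le c in \<open>force simp: abs_le_iff\<close>)+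
  have "((\<lambda>t. 1 / ((b - t) * sqrt (a\<^sup>2 - t\<^sup>2))) has_integral arcsin (w a) / c - arcsin (w (-a)) / c) {-a..a}"
    using a deriv cont
    by (intro fundamental_theorem_of_calculus_interior) (auto simp: has_real_derivative_iff_has_vector_derivative)
  moreover have "w a = 1" using a b by (simp add: w_def power2_eq_square right_diff_distrib[symmetric] mult.commute)
  moreover have "w (-a) = -1"
  proof -
    have eq: "b * -a - a\<^sup>2 = - (a * (b - -a))" by algebra
    have "a \<noteq> 0" "b - -a \<noteq> 0" using a b by auto
    then have "a * (b - -a) \<noteq> 0" by (rule no_zero_divisors)
    then show ?thesis unfolding w_def eq minus_divide_left[symmetric] by (metis divide_self)
  qed
  ultimately have I: "((\<lambda>t. 1 / ((b - t) * sqrt (a\<^sup>2 - t\<^sup>2))) has_integral pi / c) {-a..a}"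
    using c by (simp add: field_simps)
  have "0 \<le> 1 / ((b - t) * sqrt (a\<^sup>2 - t\<^sup>2))" if "t \<in> {-a..a}" for t
  proof -
    have "t\<^sup>2 \<le> a\<^sup>2" using that by (auto simp: abs_le_square_iff[symmetric] abs_le_iff)
    then show ?thesis using that b by simp
  qed
  then show ?thesis using nn_integral_has_integral_lebesgue'[OF _ I] by (simp add: c_def)
qed

section \<open>Radial integrals of the density\<close>

text \<open>
  A direction \<open>q\<close> of any length is allowed because the fan coordinates below use \<open>q = w + m *\<^sub>R w'\<close>;
  the radial integral then scales by \<open>1 / (norm q)\<^sup>2\<close>. The number \<open>e\<close> is the signed distance from
  \<open>A\<close> to the foot of the perpendicular from \<open>c\<close> to the line, so \<open>e \<le> b\<close> says that \<open>A\<close> lies in the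
  large disc and gives \<open>\<rho> = e + t \<le> b + t\<close>. In the equality case \<open>0 \<le> e\<close> means that the ray points
  into the large disc, and \<open>R\<^sup>2 - e\<^sup>2 < r\<^sup>2\<close> that its line passes at distance less than \<open>r\<close> from \<open>c\<close>.
\<close>

lemma
  fixes A c q :: "'a::euclidean_space"
  assumes r: "0 < r" "r < R" and q: "q \<noteq> 0" and A: "norm (A - c) \<le> R"
  defines "I \<equiv> (\<integral>\<^sup>+ x. ennreal (x * disc_density c r R (A + x *\<^sub>R q)) * indicator {0<..} x \<partial>lborel)"
  defines "e \<equiv> - ((A - c) \<bullet> q) / norm q"
  shows nn_integral_disc_density_ray_le: "I \<le> ennreal (1 / (norm q)\<^sup>2)"
    and nn_integral_disc_density_ray_eq:
      "norm (A - c) = R \<Longrightarrow> 0 \<le> e \<Longrightarrow> R\<^sup>2 - e\<^sup>2 < r\<^sup>2 \<Longrightarrow> I = ennreal (1 / (norm q)\<^sup>2)"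
proof -
  \<comment> \<open>The square of the distance from the centre to the line.\<close>
  define s2 where "s2 = (norm (A - c))\<^sup>2 - e\<^sup>2"
  define C where "C = sqrt (R\<^sup>2 - r\<^sup>2) / pi"
  define h where "h x = ennreal (x * disc_density c r R (A + x *\<^sub>R q)) * indicator {0<..} x" for x
  have nq: "norm q > 0" using q by simp
  have rR: "R\<^sup>2 - r\<^sup>2 > 0" using r by (simp add: power_strict_mono)
  have [measurable]: "h \<in> borel_measurable borel" unfolding h_def by measurable
  have I: "I = ennreal (1 / norm q) * (\<integral>\<^sup>+ t. h ((e + t) / norm q) \<partial>lborel)"
  proof -
    have "I = ennreal \<bar>1 / norm q\<bar> * (\<integral>\<^sup>+ t. h (e / norm q + 1 / norm q * t) \<partial>lborel)"
      unfolding I_def h_def[symmetric] by (rule nn_integral_real_affine) (use nq in auto)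
    also have "(\<lambda>t. h (e / norm q + 1 / norm q * t)) = (\<lambda>t. h ((e + t) / norm q))"
      by (simp add: add_divide_distrib)
    finally show ?thesis using nq by simp
  qed
  have "\<bar>e\<bar> \<le> norm (A - c)"
    using Cauchy_Schwarz_ineq2[of "A - c" q] nq by (simp add: e_def field_simps)
  then have s2: "0 \<le> s2" unfolding s2_def by (simp add: abs_le_square_iff[symmetric])
  have dist2: "(norm (A + ((e + t) / norm q) *\<^sub>R q - c))\<^sup>2 = s2 + t\<^sup>2" for t
  proof -
    have "(norm ((A - c) + k *\<^sub>R q))\<^sup>2 = (norm (A - c))\<^sup>2 + 2 * k * ((A - c) \<bullet> q) + k\<^sup>2 * (norm q)\<^sup>2" for k
      unfolding power2_norm_eq_inner
      by (simp add: inner_add_left inner_add_right inner_commute[of q "A - c"] power2_eq_square distrib_left)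
    then have "(norm ((A - c) + ((e + t) / norm q) *\<^sub>R q))\<^sup>2
        = (norm (A - c))\<^sup>2 + 2 * ((e + t) / norm q) * ((A - c) \<bullet> q) + ((e + t) / norm q)\<^sup>2 * (norm q)\<^sup>2" .
    also have "\<dots> = (norm (A - c))\<^sup>2 - 2 * (e + t) * e + (e + t)\<^sup>2"
      using nq by (simp add: e_def power_divide)
    also have "\<dots> = s2 + t\<^sup>2" unfolding s2_def by algebra
    finally show ?thesis by (simp add: algebra_simps)
  qed
  have inside: "norm (A + ((e + t) / norm q) *\<^sub>R q - c) < r \<longleftrightarrow> s2 + t\<^sup>2 < r\<^sup>2" for t
  proof -
    define y where "y = norm (A + ((e + t) / norm q) *\<^sub>R q - c)"
    have "0 \<le> y" "y\<^sup>2 = s2 + t\<^sup>2" unfolding y_def by (auto simp: dist2)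
    then show ?thesis using abs_le_square_iff[of r y] r unfolding y_def[symmetric] by auto
  qed
  (* If the line misses the open small disc then the density vanishes on it; otherwise the half
     chords a < b are positive and I is compared with the kernel k. *)
  have main: "I \<le> ennreal (1 / (norm q)\<^sup>2)
      \<and> (norm (A - c) = R \<longrightarrow> 0 \<le> e \<longrightarrow> R\<^sup>2 - e\<^sup>2 < r\<^sup>2 \<longrightarrow> I = ennreal (1 / (norm q)\<^sup>2))"
  proof (cases "s2 < r\<^sup>2")
    case False
    have "h ((e + t) / norm q) = 0" for t
    proof -
      have "\<not> s2 + t\<^sup>2 < r\<^sup>2" using False zero_le_power2[of t] by linarith
      then show ?thesis using inside[of t] by (simp add: h_def disc_density_def)
    qed
    then show ?thesis using False by (auto simp: I s2_def)
  next
    case True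
    define a where "a = sqrt (r\<^sup>2 - s2)"
    define b where "b = sqrt (R\<^sup>2 - s2)"
    have a: "0 < a" "a\<^sup>2 = r\<^sup>2 - s2" using True by (auto simp: a_def)
    have ab: "a < b" "b\<^sup>2 = R\<^sup>2 - s2" using True rR by (auto simp: a_def b_def)
    have "e\<^sup>2 \<le> b\<^sup>2" using A power_mono[OF A, of 2] by (simp add: ab s2_def)
    then have eb: "\<bar>e\<bar> \<le> b" using a(1) ab(1) by (simp add: abs_le_square_iff[symmetric])
    define k where "k t = ennreal (1 / ((b - t) * sqrt (a\<^sup>2 - t\<^sup>2))) * indicator {-a..a} t" for t
    (* The quotient replaces the factor e + t, the distance from A, by b + t; the maximum accounts
       for the part of the line behind A. *)
    have h_k: "h ((e + t) / norm q) = ennreal (C / norm q * (max 0 (e + t) / (b + t))) * k t" for t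
    proof (cases "\<bar>t\<bar> < a")
      case t: True
      then have t2: "t\<^sup>2 < a\<^sup>2" using power_strict_mono[of "\<bar>t\<bar>" a 2] by simp
      have bt: "b - t > 0" "b + t > 0" using t ab by auto
      have "disc_density c r R (A + ((e + t) / norm q) *\<^sub>R q)
          = C / ((b\<^sup>2 - t\<^sup>2) * sqrt (a\<^sup>2 - t\<^sup>2))"
        using t2 unfolding disc_density_def inside dist2 a ab C_def by (simp add: algebra_simps)
      also have "\<dots> = C / (b + t) * (1 / ((b - t) * sqrt (a\<^sup>2 - t\<^sup>2)))"
      proof -
        have "b\<^sup>2 - t\<^sup>2 = (b + t) * (b - t)" by algebra
        then show ?thesis by simp
      qed
      finally have "(e + t) / norm q * disc_density c r R (A + ((e + t) / norm q) *\<^sub>R q)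
          = (C / norm q * ((e + t) / (b + t))) * (1 / ((b - t) * sqrt (a\<^sup>2 - t\<^sup>2)))"
        by (simp add: ac_simps)
      moreover have "t \<in> {-a..a}" using t by auto
      moreover have "0 \<le> 1 / ((b - t) * sqrt (a\<^sup>2 - t\<^sup>2))" using t2 bt by simp
      ultimately show ?thesis
        using nq bt unfolding h_def k_def
        by (cases "0 < e + t") (auto simp: ennreal_mult''[symmetric] zero_less_divide_iff max_def)
    next
      case t: False
      then have "a\<^sup>2 \<le> t\<^sup>2" using abs_le_square_iff[of a t] a by simp
      then have "h ((e + t) / norm q) = 0"
        using inside[of t] a by (simp add: h_def disc_density_def)
      moreover have "k t = 0"
      proof (cases "\<bar>t\<bar> = a")
        case True
        then have "t\<^sup>2 = a\<^sup>2" by (metis power2_abs)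
        then show ?thesis by (simp add: k_def)
      qed (use t in \<open>auto simp: k_def indicator_def\<close>)
      ultimately show ?thesis by simp
    qed
    have Ck: "(\<integral>\<^sup>+ t. ennreal (C / norm q) * k t \<partial>lborel) = ennreal (1 / norm q)"
    proof -
      have "sqrt (b\<^sup>2 - a\<^sup>2) = sqrt (R\<^sup>2 - r\<^sup>2)" by (simp add: a ab)
      then have "(\<integral>\<^sup>+ t. k t \<partial>lborel) = ennreal (pi / sqrt (R\<^sup>2 - r\<^sup>2))"
        unfolding k_def using nn_integral_arcsine_kernel[OF a(1) ab(1)] by simp
      moreover have "k \<in> borel_measurable borel" unfolding k_def by measurable
      ultimately have "(\<integral>\<^sup>+ t. ennreal (C / norm q) * k t \<partial>lborel)
          = ennreal (C / norm q) * ennreal (pi / sqrt (R\<^sup>2 - r\<^sup>2))"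
        by (simp add: nn_integral_cmult)
      then show ?thesis using rR nq by (simp add: ennreal_mult''[symmetric] C_def)
    qed
    have sq: "ennreal (1 / norm q) * ennreal (1 / norm q) = ennreal (1 / (norm q)\<^sup>2)"
      using nq by (simp add: ennreal_mult''[symmetric] power2_eq_square)
    have C: "0 \<le> C / norm q" using rR by (simp add: C_def)
    have "h ((e + t) / norm q) \<le> ennreal (C / norm q) * k t" for t
    proof (cases "t \<in> {-a..a}")
      case True
      then have "max 0 (e + t) / (b + t) \<le> 1" using eb ab by (auto simp: field_simps)
      then have "C / norm q * (max 0 (e + t) / (b + t)) \<le> C / norm q"
        using C by (rule mult_left_le)
      then show ?thesis unfolding h_k by (intro mult_right_mono ennreal_leI) auto
    qed (simp add: h_k k_def)
    then have "(\<integral>\<^sup>+ t. h ((e + t) / norm q) \<partial>lborel) \<le> ennreal (1 / norm q)"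
      unfolding Ck[symmetric] by (intro nn_integral_mono)
    then have "I \<le> ennreal (1 / norm q) * ennreal (1 / norm q)"
      unfolding I by (intro mult_left_mono) auto
    moreover have "I = ennreal (1 / (norm q)\<^sup>2)" if "norm (A - c) = R" "0 \<le> e"
    proof -
      \<comment> \<open>Now \<open>A\<close> itself is the point where the line enters the large disc.\<close>
      have "b\<^sup>2 = e\<^sup>2" using that ab by (simp add: s2_def)
      then have be: "b = e" using that a ab by simp
      have "h ((e + t) / norm q) = ennreal (C / norm q) * k t" for t
      proof (cases "t \<in> {-a..a}")
        case True
        then have "max 0 (e + t) / (b + t) = 1" using ab be by auto
        then show ?thesis unfolding h_k by simp
      qed (simp add: h_k k_def)
      then show ?thesis unfolding I by (simp add: Ck sq)
    qed
    ultimately show ?thesis unfolding sq by blast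
  qed
  then show "I \<le> ennreal (1 / (norm q)\<^sup>2)"
    and "norm (A - c) = R \<Longrightarrow> 0 \<le> e \<Longrightarrow> R\<^sup>2 - e\<^sup>2 < r\<^sup>2 \<Longrightarrow> I = ennreal (1 / (norm q)\<^sup>2)"
    by blast+
qed

section \<open>Fan coordinates in the plane\<close>

definition orthonormal_pair :: "'a::real_inner \<Rightarrow> 'a \<Rightarrow> bool" where
  "orthonormal_pair w w' \<longleftrightarrow> norm w = 1 \<and> norm w' = 1 \<and> w \<bullet> w' = 0"

lemma distr_lborel_orthogonal_transformation:
  fixes T :: "real^'n::{finite,wellorder} \<Rightarrow> real^'n::_"
  assumes T: "orthogonal_transformation T"
  shows "distr lborel borel T = lborel"
proof (rule lborel_eqI[symmetric])
  fix l u :: "real^'n::_"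
  assume lu: "\<And>b. b \<in> Basis \<Longrightarrow> l \<bullet> b \<le> u \<bullet> b"
  note lin = orthogonal_transformation_linear[OF T]
    and inv = orthogonal_transformation_inv[OF T]
    and bij = orthogonal_transformation_bij[OF T]
  have [measurable]: "T \<in> borel_measurable borel"
    by (intro borel_measurable_continuous_onI linear_continuous_on linear_conv_bounded_linear[THEN iffD1] lin)
  have vim: "T -` box l u = inv T ` box l u" using bij by (simp add: bij_vimage_eq_inv_image)
  have lm: "box l u \<in> lmeasurable" by simp
  have "emeasure (distr lborel borel T) (box l u) = emeasure lborel (T -` box l u)"
    by (subst emeasure_distr) auto
  also have "\<dots> = emeasure lebesgue (inv T ` box l u)"
    using measurable_sets[of T borel borel "box l u"] by (simp add: vim)
  also have "\<dots> = ennreal (measure lebesgue (inv T ` box l u))"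
    using measurable_orthogonal_image[OF inv lm] by (simp add: emeasure_eq_measure2)
  also have "\<dots> = ennreal (measure lebesgue (box l u))"
    by (simp add: measure_orthogonal_image[OF inv lm])
  also have "\<dots> = emeasure lborel (box l u)"
    using lm by (simp add: emeasure_eq_measure2)
  finally show "emeasure (distr lborel borel T) (box l u) = (\<Prod>b\<in>Basis. (u - l) \<bullet> b)"
    using lu by (simp add: emeasure_lborel_box)
qed simp

lemma borel_measurable_vector_2 [measurable]:
  "(\<lambda>(x, y). vector [x, y] :: real^2) \<in> borel_measurable borel"
proof -
  have "(\<lambda>(x, y). vector [x, y] :: real^2) = (\<lambda>p. fst p *\<^sub>R axis 1 1 + snd p *\<^sub>R axis 2 1)"
    by (auto simp: fun_eq_iff vec_eq_iff forall_2 axis_def)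
  then show ?thesis
    by (auto intro!: borel_measurable_continuous_onI continuous_intros)
qed

lemma distr_lborel_vector2:
  "distr (lborel :: (real \<times> real) measure) borel (\<lambda>(x, y). vector [x, y] :: real^2) = lborel"
proof (rule lborel_eqI[symmetric])
  fix l u :: "real^2"
  assume lu: "\<And>b. b \<in> Basis \<Longrightarrow> l \<bullet> b \<le> u \<bullet> b"
  have B: "Basis = {axis 1 1, axis 2 1 :: real^2}"
    by (auto simp: Basis_vec_def UNIV_2)
  have ne: "axis 1 1 \<noteq> (axis 2 1 :: real^2)" by (simp add: axis_eq_axis)
  have vim: "(\<lambda>(x, y). vector [x, y] :: real^2) -` box l u = {l $ 1<..<u $ 1} \<times> {l $ 2<..<u $ 2}"
    by (auto simp: mem_box_cart forall_2)
  have le: "l $ 1 \<le> u $ 1" "l $ 2 \<le> u $ 2" using lu[of "axis 1 1"] lu[of "axis 2 1"] by (auto simp: B inner_axis)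
  have "emeasure (distr lborel borel (\<lambda>(x, y). vector [x, y] :: real^2)) (box l u)
      = emeasure lborel ({l $ 1<..<u $ 1} \<times> {l $ 2<..<u $ 2})"
    by (subst emeasure_distr) (auto simp: vim)
  also have "\<dots> = ennreal ((u $ 1 - l $ 1) * (u $ 2 - l $ 2))"
    unfolding lborel_prod[symmetric] using le
    by (subst lborel.emeasure_pair_measure_Times) (auto simp: ennreal_mult'' box_real)
  also have "(u $ 1 - l $ 1) * (u $ 2 - l $ 2) = (\<Prod>b\<in>Basis. (u - l) \<bullet> b)"
    using ne by (simp add: B inner_axis)
  finally show "emeasure (distr lborel borel (\<lambda>(x, y). vector [x, y] :: real^2)) (box l u)
      = (\<Prod>b\<in>Basis. (u - l) \<bullet> b)" .
qed simp

lemma orthonormal_pair_inner: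
  assumes "orthonormal_pair w w'"
  shows "w \<bullet> w = 1" "w' \<bullet> w' = 1" "w \<bullet> w' = 0" "w' \<bullet> w = 0"
  using assms by (auto simp: orthonormal_pair_def norm_eq_1 inner_commute)

lemma orthogonal_transformation_orthonormal_pair:
  fixes w w' :: "real^2"
  assumes "orthonormal_pair w w'"
  shows "orthogonal_transformation (\<lambda>z :: real^2. z $ 1 *\<^sub>R w + z $ 2 *\<^sub>R w')" (is "orthogonal_transformation ?T")
  unfolding orthogonal_transformation_def
proof (intro conjI allI)
  show "linear ?T" by (intro linearI) (auto simp: algebra_simps)
  fix x y
  have "?T x \<bullet> ?T y = x $ 1 * y $ 1 + x $ 2 * y $ 2"
    by (simp add: inner_add_left inner_add_right orthonormal_pair_inner[OF assms])
  then show "?T x \<bullet> ?T y = x \<bullet> y"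
    by (simp add: inner_vec_def sum_2)
qed

lemma orthonormal_pair_expansion:
  fixes w w' x :: "real^2"
  assumes w: "orthonormal_pair w w'"
  shows "x = (x \<bullet> w) *\<^sub>R w + (x \<bullet> w') *\<^sub>R w'"
proof -
  obtain z :: "real^2" where "x = z $ 1 *\<^sub>R w + z $ 2 *\<^sub>R w'"
    using orthogonal_transformation_surj[OF orthogonal_transformation_orthonormal_pair[OF w]] by (auto simp: surj_def)
  then show ?thesis
    by (simp add: inner_add_left orthonormal_pair_inner[OF w])
qed

lemma orthonormal_pair_exists:
  fixes w :: "real^2"
  assumes "norm w = 1"
  obtains w' where "orthonormal_pair w w'"
proof
  show "orthonormal_pair w (vector [- w $ 2, w $ 1])"
    using assms by (simp add: orthonormal_pair_def norm_eq_sqrt_inner inner_vec_def sum_2 add.commute)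
qed

lemma nn_integral_orthonormal_coordinates:
  fixes A w w' :: "real^2"
  assumes w: "orthonormal_pair w w'" and [measurable]: "h \<in> borel_measurable borel"
  shows "(\<integral>\<^sup>+ p. h p \<partial>lborel) = (\<integral>\<^sup>+ x. \<integral>\<^sup>+ y. h (A + x *\<^sub>R w + y *\<^sub>R w') \<partial>lborel \<partial>lborel)"
proof -
  define T where "T z = z $ 1 *\<^sub>R w + z $ 2 *\<^sub>R w'" for z :: "real^2"
  have T: "orthogonal_transformation T"
    unfolding T_def by (rule orthogonal_transformation_orthonormal_pair[OF w])
  have [measurable]: "T \<in> borel_measurable borel"
    unfolding T_def by (intro borel_measurable_continuous_onI continuous_intros)
  have "(\<integral>\<^sup>+ p. h p \<partial>lborel) = (\<integral>\<^sup>+ p. h (A + p) \<partial>lborel)"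
    by (subst lborel_distr_plus[of A, symmetric]) (simp add: nn_integral_distr)
  also have "\<dots> = (\<integral>\<^sup>+ p. h (A + T p) \<partial>lborel)"
    by (subst distr_lborel_orthogonal_transformation[OF T, symmetric]) (simp add: nn_integral_distr)
  also have "\<dots> = (\<integral>\<^sup>+ z. h (A + T (case z of (x, y) \<Rightarrow> vector [x, y])) \<partial>lborel)"
    by (subst distr_lborel_vector2[symmetric]) (simp add: nn_integral_distr)
  also have "\<dots> = (\<integral>\<^sup>+ z. h (A + fst z *\<^sub>R w + snd z *\<^sub>R w') \<partial>(lborel \<Otimes>\<^sub>M lborel))"
    unfolding lborel_prod by (intro nn_integral_cong) (auto simp: T_def add.assoc)
  also have "\<dots> = (\<integral>\<^sup>+ x. \<integral>\<^sup>+ y. h (A + x *\<^sub>R w + y *\<^sub>R w') \<partial>lborel \<partial>lborel)"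
    by (subst lborel.nn_integral_fst[symmetric]) auto
  finally show ?thesis .
qed

text \<open>
  In cartesian coordinates along \<open>w\<close> and \<open>w'\<close>, the substitution \<open>y = x * m\<close> in the inner integral
  produces the factor \<open>x\<close>, and Tonelli's theorem exchanges the slope \<open>m\<close> with \<open>x\<close>. This does the
  work of polar coordinates around \<open>A\<close> on a half-plane with one-dimensional substitutions only.
\<close>

lemma nn_integral_fan_coordinates:
  fixes A w w' :: "real^2"
  assumes w: "orthonormal_pair w w'" and [measurable]: "h \<in> borel_measurable borel"
  shows "(\<integral>\<^sup>+ p. h p * indicator {p. 0 < (p - A) \<bullet> w} p \<partial>lborel)
       = (\<integral>\<^sup>+ m. \<integral>\<^sup>+ x. ennreal x * h (A + x *\<^sub>R (w + m *\<^sub>R w')) * indicator {0<..} x \<partial>lborel \<partial>lborel)"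
proof -
  have wn: "w \<bullet> w = 1" "w' \<bullet> w = 0"
    using w by (auto simp: orthonormal_pair_def norm_eq_1 inner_commute)
  have "(\<integral>\<^sup>+ p. h p * indicator {p. 0 < (p - A) \<bullet> w} p \<partial>lborel)
     = (\<integral>\<^sup>+ x. \<integral>\<^sup>+ y. h (A + x *\<^sub>R w + y *\<^sub>R w') * indicator {0<..} x \<partial>lborel \<partial>lborel)"
    by (subst nn_integral_orthonormal_coordinates[OF w, of _ A])
       (auto simp: inner_add_left inner_diff_left wn indicator_def intro!: nn_integral_cong)
  also have "\<dots> = (\<integral>\<^sup>+ x. \<integral>\<^sup>+ m. ennreal x * h (A + x *\<^sub>R (w + m *\<^sub>R w')) * indicator {0<..} x \<partial>lborel \<partial>lborel)"
  proof (rule nn_integral_cong)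
    fix x :: real
    show "(\<integral>\<^sup>+ y. h (A + x *\<^sub>R w + y *\<^sub>R w') * indicator {0<..} x \<partial>lborel)
        = (\<integral>\<^sup>+ m. ennreal x * h (A + x *\<^sub>R (w + m *\<^sub>R w')) * indicator {0<..} x \<partial>lborel)"
    proof (cases "0 < x")
      case True
      have "(\<integral>\<^sup>+ y. h (A + x *\<^sub>R w + y *\<^sub>R w') \<partial>lborel)
          = ennreal \<bar>x\<bar> * (\<integral>\<^sup>+ m. h (A + x *\<^sub>R w + (0 + x * m) *\<^sub>R w') \<partial>lborel)"
        using True by (intro nn_integral_real_affine) auto
      also have "\<dots> = (\<integral>\<^sup>+ m. ennreal x * h (A + x *\<^sub>R (w + m *\<^sub>R w')) \<partial>lborel)"
        using True by (subst nn_integral_cmult[symmetric]) (auto simp: scaleR_add_right add.assoc)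
      finally show ?thesis using True by simp
    qed simp
  qed
  also have "\<dots> = (\<integral>\<^sup>+ m. \<integral>\<^sup>+ x. ennreal x * h (A + x *\<^sub>R (w + m *\<^sub>R w')) * indicator {0<..} x \<partial>lborel \<partial>lborel)"
    by (rule lborel_pair.Fubini'[symmetric]) measurable
  finally show ?thesis .
qed

section \<open>Angular domains as fans\<close>

text \<open>
  A supporting line of \<open>D\<close> at \<open>A + u\<close>, a relatively interior point of the halfline, has to contain
  the whole halfline, in particular the vertex \<open>A\<close>.
\<close>

lemma supporting_line_of_halfline:
  assumes D: "closed D" "convex D" "interior D \<noteq> {}"
    and u: "halfline A u \<subseteq> frontier D"
  obtains n where "n \<noteq> 0" "n \<bullet> u = 0" "\<And>p. p \<in> D \<Longrightarrow> 0 \<le> n \<bullet> (p - A)"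
    "\<And>p. p \<in> interior D \<Longrightarrow> 0 < n \<bullet> (p - A)"
proof -
  have fD: "frontier D \<subseteq> D" using D(1) by (simp add: frontier_subset_eq)
  have mem: "A + t *\<^sub>R u \<in> frontier D" if "0 \<le> t" for t
    using that u by (auto simp: halfline_def)
  have ri: "rel_interior D = interior D" using D(3) by (rule rel_interior_nonempty_interior)
  have "A + 1 *\<^sub>R u \<in> D" "A + 1 *\<^sub>R u \<notin> rel_interior D"
    using mem[of 1] fD unfolding ri by (auto simp: frontier_def)
  from supporting_hyperplane_rel_boundary[OF D(2) this]
  obtain n where n: "n \<noteq> 0" "\<And>p. p \<in> D \<Longrightarrow> n \<bullet> (A + 1 *\<^sub>R u) \<le> n \<bullet> p"
    "\<And>p. p \<in> interior D \<Longrightarrow> n \<bullet> (A + 1 *\<^sub>R u) < n \<bullet> p"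
    unfolding ri by metis
  \<comment> \<open>The supporting functional is minimal at \<open>A + u\<close>, the midpoint of \<open>A\<close> and \<open>A + 2 *\<^sub>R u\<close> in \<open>D\<close>.\<close>
  have "A + 0 *\<^sub>R u \<in> D" "A + 2 *\<^sub>R u \<in> D" using mem[of 0] mem[of 2] fD by auto
  then have "n \<bullet> u = 0" using n(2)[of "A + 0 *\<^sub>R u"] n(2)[of "A + 2 *\<^sub>R u"]
    by (simp add: inner_add_right)
  then show thesis using n that[of n] by (simp add: inner_add_right inner_diff_right)
qed

text \<open>
  The halfline lies on a line that supports \<open>D\<close>. Reflecting an interior point \<open>y\<close> in the point
  \<open>A - u\<close> of that line, behind the halfline, gives a point \<open>z\<close> outside \<open>D\<close>. The segment from \<open>y\<close> to
  \<open>z\<close> meets the line only in \<open>A - u\<close>, so it leaves \<open>D\<close> without meeting the halfline.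
\<close>

lemma frontier_not_single_halfline:
  fixes D :: "(real^2) set"
  assumes D: "closed D" "convex D" "interior D \<noteq> {}" and u: "u \<noteq> 0"
  shows "frontier D \<noteq> halfline A u"
proof
  assume F: "frontier D = halfline A u"
  then obtain n where n: "n \<bullet> u = 0" "\<And>p. p \<in> D \<Longrightarrow> 0 \<le> n \<bullet> (p - A)"
    "\<And>p. p \<in> interior D \<Longrightarrow> 0 < n \<bullet> (p - A)"
    using supporting_line_of_halfline[OF D, of A u] by blast
  obtain y where y: "y \<in> interior D" using D(3) by blast
  define z where "z = 2 *\<^sub>R (A - u) - y"
  have nz: "n \<bullet> (z - A) = - (n \<bullet> (y - A))"
    by (simp add: z_def n(1) inner_diff_right)
  have "z \<notin> D" using nz n(2)[of z] n(3)[OF y] by auto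
  then have "closed_segment y z \<inter> frontier D \<noteq> {}"
    using y interior_subset[of D] by (intro connected_Int_frontier) auto
  then obtain x where x: "x \<in> closed_segment y z" "x \<in> halfline A u" unfolding F by blast
  then obtain t where t: "0 \<le> t" "x = A + t *\<^sub>R u" by (auto simp: halfline_def)
  obtain s where s: "(1 - s) *\<^sub>R y + s *\<^sub>R z = A + t *\<^sub>R u"
    using x(1) unfolding t(2) in_segment by metis
  have "n \<bullet> ((1 - s) *\<^sub>R y + s *\<^sub>R z - A) = (1 - s) * (n \<bullet> (y - A)) + s * (n \<bullet> (z - A))"
    by (simp add: inner_diff_right inner_add_right left_diff_distrib right_diff_distrib)
  also have "\<dots> = (1 - 2 * s) * (n \<bullet> (y - A))"
    unfolding nz by algebra
  finally have "n \<bullet> ((1 - s) *\<^sub>R y + s *\<^sub>R z - A) = (1 - 2 * s) * (n \<bullet> (y - A))" .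
  then have "(1 - 2 * s) * (n \<bullet> (y - A)) = 0"
    unfolding s by (simp add: n(1))
  then have "s = 1 / 2" using n(3)[OF y] by simp
  then have "(1/2) *\<^sub>R y + (1/2) *\<^sub>R z = A + t *\<^sub>R u"
    using s unfolding \<open>s = 1 / 2\<close> by simp
  moreover have "(1/2) *\<^sub>R y + (1/2) *\<^sub>R z = A - u"
    unfolding z_def by (simp add: scaleR_diff_right)
  ultimately have "(1 + t) *\<^sub>R u = 0" by (simp add: algebra_simps)
  then show False using u t by simp
qed

text \<open>
  Here \<open>w\<close> is the direction of the bisector and \<open>w'\<close> is perpendicular to it; for \<open>0 < \<alpha>\<close> the inequality says that
  the direction of \<open>p - A\<close> deviates from \<open>w\<close> by at most \<open>\<alpha> / 2\<close>. Writing it without a quotient covers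
  the half-plane \<open>\<alpha> = pi\<close>, where it reads \<open>0 \<le> (p - A) \<bullet> w\<close>, and the halfline \<open>\<alpha> = 0\<close>, where it
  confines \<open>p\<close> to a line. Convexity enters through supporting lines along the two sides: their
  half-planes intersect in the convex sector between the sides, so that \<open>D\<close> is not the reflex one.
\<close>

lemma angular_domain_subset_fan:
  assumes "angular_domain A \<alpha> D"
  obtains w w' where "orthonormal_pair w w'" "0 \<le> \<alpha>" "\<alpha> \<le> pi"
    "\<forall>p\<in>D. \<bar>(p - A) \<bullet> w'\<bar> * cos (\<alpha> / 2) \<le> ((p - A) \<bullet> w) * sin (\<alpha> / 2)"
proof -
  from assms obtain u0 v0 where uv0: "u0 \<noteq> 0" "v0 \<noteq> 0" "\<alpha> = enclosed_angle u0 v0"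
    and D: "closed D" "convex D" and F0: "frontier D = halfline A u0 \<union> halfline A v0"
    and thin: "interior D = {} \<longrightarrow> halfline A u0 = halfline A v0"
    unfolding angular_domain_def by blast
  define u where "u = sgn u0"
  define v where "v = sgn v0"
  have nu: "norm u = 1" "norm v = 1" using uv0 by (auto simp: u_def v_def norm_sgn)
  then have iu: "u \<bullet> u = 1" "v \<bullet> v = 1" by (auto simp: norm_eq_1)
  have hl: "halfline A u0 = halfline A u" "halfline A v0 = halfline A v"
    unfolding u_def v_def sgn_div_norm using uv0 by (auto simp: halfline_scale)
  have \<alpha>: "\<alpha> = arccos (u \<bullet> v)"
    using uv0 by (simp add: enclosed_angle_def u_def v_def sgn_div_norm divide_inverse mult_ac)
  have "\<bar>u \<bullet> v\<bar> \<le> 1" using Cauchy_Schwarz_ineq2[of u v] nu by simp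
  then have uv: "-1 \<le> u \<bullet> v" "u \<bullet> v \<le> 1" by auto
  have cos\<alpha>: "cos \<alpha> = u \<bullet> v" and \<alpha>_bounds: "0 \<le> \<alpha>" "\<alpha> \<le> pi"
    unfolding \<alpha> using uv by (auto intro: cos_arccos arccos_lbound arccos_ubound)
  note F = F0[unfolded hl]
  have dist_uv: "(u - v) \<bullet> (u - v) = 2 - 2 * cos \<alpha>" "(u + v) \<bullet> (u + v) = 2 + 2 * cos \<alpha>"
    by (auto simp: cos\<alpha> inner_diff_left inner_diff_right inner_add_left inner_add_right iu inner_commute)
  show thesis
  proof (cases "interior D = {}")
    case True
    then have Dh: "D = halfline A u" "halfline A u = halfline A v"
      using F thin hl D(1) by (auto simp: frontier_def)
    have "A + 1 *\<^sub>R u \<in> halfline A u" unfolding halfline_def using zero_le_one by blast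
    then obtain t where t: "t \<ge> 0" "u = t *\<^sub>R v" unfolding Dh(2) by (auto simp: halfline_def)
    then have "norm u = t" using nu by simp
    then have "t = 1" using nu by simp
    then have "\<alpha> = 0" using t iu by (simp add: \<alpha>)
    obtain w' where w': "orthonormal_pair u w'" using orthonormal_pair_exists nu by blast
    show thesis
    proof (rule that[OF w' \<alpha>_bounds], rule ballI)
      show "\<bar>(p - A) \<bullet> w'\<bar> * cos (\<alpha> / 2) \<le> (p - A) \<bullet> u * sin (\<alpha> / 2)" if "p \<in> D" for p
        using that orthonormal_pair_inner[OF w'] by (auto simp: \<open>\<alpha> = 0\<close> Dh(1) halfline_def)
    qed
  next
    case int: False
    obtain n1 where n1: "n1 \<noteq> 0" "n1 \<bullet> u = 0" "\<And>p. p \<in> D \<Longrightarrow> 0 \<le> n1 \<bullet> (p - A)"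
      by (rule supporting_line_of_halfline[OF D int, of A u]) (use F in auto)
    obtain n2 where n2: "n2 \<noteq> 0" "n2 \<bullet> v = 0" "\<And>p. p \<in> D \<Longrightarrow> 0 \<le> n2 \<bullet> (p - A)"
      by (rule supporting_line_of_halfline[OF D int, of A v]) (use F in auto)
    have "\<alpha> \<noteq> 0"
    proof
      assume "\<alpha> = 0"
      then have "u = v" using dist_uv(1) by simp
      moreover have "u \<noteq> 0" using nu by auto
      ultimately show False using frontier_not_single_halfline[OF D int, of u A] F by simp
    qed
    show thesis
    proof (cases "\<alpha> = pi")
      case True
      show thesis
      proof (rule that[of "sgn n1" u])
        show "orthonormal_pair (sgn n1) u"
          using n1 nu by (simp add: orthonormal_pair_def norm_sgn sgn_div_norm)
        show "\<forall>p\<in>D. \<bar>(p - A) \<bullet> u\<bar> * cos (\<alpha> / 2) \<le> (p - A) \<bullet> sgn n1 * sin (\<alpha> / 2)"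
          using n1(3) by (simp add: True sgn_div_norm inner_commute)
      qed (use True \<alpha>_bounds in auto)
    next
      case False
      define co where "co = cos (\<alpha> / 2)"
      define si where "si = sin (\<alpha> / 2)"
      have cs: "0 < co" "0 < si" 
        unfolding co_def si_def using \<open>\<alpha> \<noteq> 0\<close> False \<alpha>_bounds by (auto intro!: cos_gt_zero sin_gt_zero)
      have c2: "cos \<alpha> = 2 * co\<^sup>2 - 1" "cos \<alpha> = 1 - 2 * si\<^sup>2"
        using cos_double_cos[of "\<alpha> / 2"] cos_double_sin[of "\<alpha> / 2"] by (auto simp: co_def si_def)
      define w where "w = (1 / (2 * co)) *\<^sub>R (u + v)"
      define w' where "w' = (1 / (2 * si)) *\<^sub>R (u - v)"
      have "w \<bullet> w = 1" using cs dist_uv(2) unfolding w_def c2(1) by (simp add: power2_eq_square)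
      moreover have "w' \<bullet> w' = 1" using cs dist_uv(1) unfolding w'_def c2(2) by (simp add: power2_eq_square)
      moreover have "(u + v) \<bullet> (u - v) = 0"
        by (simp add: inner_add_left inner_diff_right iu inner_commute[of v u])
      then have "w \<bullet> w' = 0"
        unfolding w_def w'_def inner_scaleR_left inner_scaleR_right by simp
      ultimately have w: "orthonormal_pair w w'" by (simp add: orthonormal_pair_def norm_eq_1)
      have u: "u = co *\<^sub>R w + si *\<^sub>R w'" and v: "v = co *\<^sub>R w - si *\<^sub>R w'"
      proof -
        have half: "co *\<^sub>R w = (1 / 2) *\<^sub>R (u + v)" "si *\<^sub>R w' = (1 / 2) *\<^sub>R (u - v)"
          using cs by (simp_all add: w_def w'_def)
        show "u = co *\<^sub>R w + si *\<^sub>R w'"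
          unfolding half scaleR_add_right[symmetric] by simp
        show "v = co *\<^sub>R w - si *\<^sub>R w'"
          unfolding half scaleR_diff_right[symmetric] by simp
      qed
      have in_D: "A + u \<in> D" "A + v \<in> D"
      proof -
        have "A + 1 *\<^sub>R u \<in> frontier D" "A + 1 *\<^sub>R v \<in> frontier D"
          unfolding F halfline_def using zero_le_one by blast+
        then show "A + u \<in> D" "A + v \<in> D" using D(1) frontier_subset_closed by auto
      qed
      (* A supporting normal n along one side is orthogonal to that side and has a nonnegative
         product with the other one, since D contains it. In the plane this makes n a positive
         multiple of the inner normal of the sector. The sign \<sigma> tells which side is meant. *)
      have side: "((p - A) \<bullet> w') * (\<sigma> * co) \<le> ((p - A) \<bullet> w) * si"
        if n: "n \<noteq> 0" "n \<bullet> (co *\<^sub>R w + (\<sigma> * si) *\<^sub>R w') = 0" "0 \<le> n \<bullet> (co *\<^sub>R w - (\<sigma> * si) *\<^sub>R w')"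
          "0 \<le> n \<bullet> (p - A)" and \<sigma>: "\<sigma> * \<sigma> = 1" for n p \<sigma>
      proof -
        define a where "a = n \<bullet> w"
        define b where "b = n \<bullet> w'"
        have ab: "co * a + \<sigma> * si * b = 0" "0 \<le> co * a - \<sigma> * si * b"
          using n(2,3) by (auto simp: a_def b_def inner_add_right inner_diff_right)
        then have "0 \<le> co * a" by linarith
        then have "0 \<le> a" using cs by (simp add: zero_le_mult_iff)
        moreover have "a \<noteq> 0"
        proof
          assume "a = 0"
          then have "\<sigma> * si * b = 0" using ab by simp
          then have "b = 0" using \<sigma> cs by auto
          then have "n = 0" using \<open>a = 0\<close> orthonormal_pair_expansion[OF w, of n] by (simp add: a_def b_def)
          then show False using n(1) by simp
        qed
        ultimately have a: "0 < a" by simp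
        have "n \<bullet> (p - A) = a * ((p - A) \<bullet> w) + b * ((p - A) \<bullet> w')"
          by (subst orthonormal_pair_expansion[OF w, of n]) (simp add: a_def b_def inner_add_left inner_commute[of "p - A"])
        then have "0 \<le> si * (a * ((p - A) \<bullet> w) + b * ((p - A) \<bullet> w'))" using n(4) cs by simp
        also have "\<dots> = a * (((p - A) \<bullet> w) * si) + (si * b) * ((p - A) \<bullet> w')" by (simp add: algebra_simps)
        also have "si * b = \<sigma> * (\<sigma> * si * b)" using \<sigma> by (simp add: mult.assoc[symmetric])
        also have "\<sigma> * si * b = - (co * a)" using ab(1) by linarith
        finally have "0 \<le> a * (((p - A) \<bullet> w) * si - ((p - A) \<bullet> w') * (\<sigma> * co))" by (simp add: algebra_simps)
        then show ?thesis using a by (simp add: zero_le_mult_iff)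
      qed
      show thesis
      proof (rule that[OF w \<alpha>_bounds], rule ballI)
        fix p assume p: "p \<in> D"
        have "((p - A) \<bullet> w') * (1 * co) \<le> ((p - A) \<bullet> w) * si"
          using n1(1,2) n1(3)[OF p] n1(3)[OF in_D(2)] by (intro side[of n1]) (auto simp: u v)
        moreover have "((p - A) \<bullet> w') * (-1 * co) \<le> ((p - A) \<bullet> w) * si"
          using n2(1,2) n2(3)[OF p] n2(3)[OF in_D(1)] by (intro side[of n2]) (auto simp: u v)
        ultimately have "\<bar>((p - A) \<bullet> w') * co\<bar> \<le> ((p - A) \<bullet> w) * si" by simp
        then show "\<bar>(p - A) \<bullet> w'\<bar> * cos (\<alpha> / 2) \<le> (p - A) \<bullet> w * sin (\<alpha> / 2)"
          using cs by (simp add: abs_mult co_def[symmetric] si_def[symmetric])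
      qed
    qed
  qed
qed

section \<open>Measure of a fan and of the disc\<close>

lemma nn_integral_arctan_kernel_Icc:
  assumes "0 \<le> M"
  shows "(\<integral>\<^sup>+ m. ennreal (1 / (1 + m\<^sup>2)) * indicator {-M..M} m \<partial>lborel) = ennreal (2 * arctan M)"
proof -
  have "(\<integral>\<^sup>+ m. ennreal (inverse (1 + m\<^sup>2)) * indicator {-M..M} m \<partial>lborel) = arctan M - arctan (- M)"
    using assms by (intro nn_integral_FTC_Icc DERIV_arctan) auto
  then show ?thesis by (simp add: inverse_eq_divide arctan_minus)
qed

lemma nn_integral_arctan_kernel_UNIV_le:
  "(\<integral>\<^sup>+ m. ennreal (1 / (1 + m\<^sup>2)) \<partial>lborel) \<le> ennreal pi"
proof -
  define k where "k m = ennreal (1 / (1 + m\<^sup>2))" for m :: real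
  have [measurable]: "k \<in> borel_measurable borel" unfolding k_def by measurable
  have half: "(\<integral>\<^sup>+ m. k m * indicator {0..} m \<partial>lborel) = ennreal (pi / 2)"
  proof -
    have "(\<integral>\<^sup>+ m. ennreal (inverse (1 + m\<^sup>2)) * indicator {0..} m \<partial>lborel) = pi / 2 - arctan 0"
      by (intro nn_integral_FTC_atLeast DERIV_arctan tendsto_arctan_at_top) auto
    then show ?thesis by (simp add: k_def inverse_eq_divide)
  qed
  have "(\<integral>\<^sup>+ m. k m * indicator {..0} m \<partial>lborel) = (\<integral>\<^sup>+ m. k m * indicator {0..} m \<partial>lborel)"
    by (subst nn_integral_real_affine[of _ "-1" 0])
       (auto simp: k_def indicator_def intro!: nn_integral_cong)
  moreover have "(\<integral>\<^sup>+ m. k m \<partial>lborel) \<le> (\<integral>\<^sup>+ m. k m * indicator {0..} m + k m * indicator {..0} m \<partial>lborel)"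
    by (intro nn_integral_mono) (auto simp: indicator_def)
  ultimately have "(\<integral>\<^sup>+ m. k m \<partial>lborel) \<le> ennreal (pi / 2) + ennreal (pi / 2)"
    by (simp add: nn_integral_add half)
  also have "\<dots> = ennreal pi" by (simp add: ennreal_plus[symmetric] del: ennreal_plus)
  finally show ?thesis by (simp add: k_def)
qed

lemma nn_integral_arctan_kernel_fan_le:
  assumes \<alpha>: "0 \<le> \<alpha>" "\<alpha> \<le> pi"
  shows "(\<integral>\<^sup>+ m. ennreal (1 / (1 + m\<^sup>2)) * indicator {m. \<bar>m\<bar> * cos (\<alpha> / 2) \<le> sin (\<alpha> / 2)} m \<partial>lborel)
         \<le> ennreal \<alpha>"
proof (cases "\<alpha> = pi")
  case True
  have "(\<integral>\<^sup>+ m. ennreal (1 / (1 + m\<^sup>2)) * indicator {m. \<bar>m\<bar> * cos (\<alpha> / 2) \<le> sin (\<alpha> / 2)} m \<partial>lborel)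
      \<le> (\<integral>\<^sup>+ m. ennreal (1 / (1 + m\<^sup>2)) \<partial>lborel)"
    by (intro nn_integral_mono) (auto simp: indicator_def)
  also have "\<dots> \<le> ennreal pi" by (rule nn_integral_arctan_kernel_UNIV_le)
  finally show ?thesis by (simp add: True)
next
  case False
  then have h: "- (pi / 2) < \<alpha> / 2" "\<alpha> / 2 < pi / 2" using \<alpha> by auto
  have "0 < cos (\<alpha> / 2)" using h by (intro cos_gt_zero_pi) auto
  then have slope: "\<bar>m\<bar> * cos (\<alpha> / 2) \<le> sin (\<alpha> / 2) \<longleftrightarrow> \<bar>m\<bar> \<le> tan (\<alpha> / 2)" for m
    by (simp add: tan_def pos_le_divide_eq)
  have Icc: "{m. \<bar>m\<bar> * cos (\<alpha> / 2) \<le> sin (\<alpha> / 2)} = {- tan (\<alpha> / 2)..tan (\<alpha> / 2)}"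
    unfolding slope by auto
  have "0 \<le> tan (\<alpha> / 2)"
    using \<alpha> h by (intro tan_pos_pi2_le) auto
  from nn_integral_arctan_kernel_Icc[OF this] show ?thesis
    unfolding Icc arctan_tan[OF h] by simp
qed

lemma AE_not_in_hyperplane:
  fixes w A :: "'a::euclidean_space"
  assumes "w \<noteq> 0"
  shows "AE p in lborel. (p - A) \<bullet> w \<noteq> 0"
proof -
  have "{p. w \<bullet> p = w \<bullet> A} \<in> null_sets lebesgue"
    using negligible_hyperplane[of w "w \<bullet> A"] assms by (simp add: negligible_iff_null_sets)
  moreover have "{p. w \<bullet> p = w \<bullet> A} \<in> sets lborel" by measurable
  ultimately have "{p. w \<bullet> p = w \<bullet> A} \<in> null_sets lborel"
    by (simp add: null_sets_completion_iff)
  moreover have "(p - A) \<bullet> w = w \<bullet> p - w \<bullet> A" for p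
    by (simp add: inner_diff_right inner_commute)
  ultimately show ?thesis
    using AE_not_in[of "{p. w \<bullet> p = w \<bullet> A}" lborel] by simp
qed

lemma norm_orthonormal_direction:
  assumes "orthonormal_pair w w'"
  shows "(norm (w + m *\<^sub>R w'))\<^sup>2 = 1 + m\<^sup>2" "w + m *\<^sub>R w' \<noteq> 0"
proof -
  show *: "(norm (w + m *\<^sub>R w'))\<^sup>2 = 1 + m\<^sup>2"
    unfolding power2_norm_eq_inner
    by (simp add: inner_add_left inner_add_right orthonormal_pair_inner[OF assms] power2_eq_square)
  have "1 + m\<^sup>2 > 0" by (simp add: add_pos_nonneg)
  then show "w + m *\<^sub>R w' \<noteq> 0" using * by fastforce
qed

text \<open>
  Up to a null set, all of \<open>D\<close> lies in the open half-plane \<open>0 < (p - A) \<bullet> w\<close> where the fan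
  coordinates apply: for \<open>0 < \<alpha>\<close> only the bounding line is missed, and for \<open>\<alpha> = 0\<close> the set \<open>D\<close> is
  contained in a line.
\<close>

lemma nn_integral_disc_density_fan_le:
  fixes A c w w' :: "real^2"
  assumes r: "0 < r" "r < R" and A: "A \<in> cball c R" and w: "orthonormal_pair w w'"
    and [measurable]: "D \<in> sets borel" and \<alpha>: "0 \<le> \<alpha>" "\<alpha> \<le> pi"
    and D: "\<And>p. p \<in> D \<Longrightarrow> \<bar>(p - A) \<bullet> w'\<bar> * cos (\<alpha> / 2) \<le> ((p - A) \<bullet> w) * sin (\<alpha> / 2)"
  shows "(\<integral>\<^sup>+ p. ennreal (disc_density c r R p) * indicator D p \<partial>lborel) \<le> ennreal \<alpha>"
proof -
  let ?f = "\<lambda>p. ennreal (disc_density c r R p)"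
  let ?S = "{m. \<bar>m\<bar> * cos (\<alpha> / 2) \<le> sin (\<alpha> / 2)}"
  note wn = orthonormal_pair_inner[OF w]
  have [measurable]: "?S \<in> sets borel" by measurable
  have "w \<noteq> 0" "w' \<noteq> 0" using wn by auto
  from this[THEN AE_not_in_hyperplane, of A]
  have "AE p in lborel. indicator D p \<le> (indicator D p * indicator {p. 0 < (p - A) \<bullet> w} p :: ennreal)"
  proof eventually_elim
    case (elim p)
    have "0 < (p - A) \<bullet> w" if "p \<in> D"
    proof (cases "\<alpha> = 0")
      case True
      then show ?thesis using D[OF that] elim by simp
    next
      case False
      then have "0 < sin (\<alpha> / 2)" "0 \<le> cos (\<alpha> / 2)"
        using \<alpha> by (auto intro!: sin_gt_zero cos_ge_zero)
      moreover from this have "0 \<le> (p - A) \<bullet> w * sin (\<alpha> / 2)"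
        using D[OF that] by (meson abs_ge_zero mult_nonneg_nonneg order_trans)
      ultimately show ?thesis using elim by (auto simp: zero_le_mult_iff)
    qed
    then show ?case by (auto simp: indicator_def)
  qed
  then have "(\<integral>\<^sup>+ p. ?f p * indicator D p \<partial>lborel)
      \<le> (\<integral>\<^sup>+ p. (?f p * indicator D p) * indicator {p. 0 < (p - A) \<bullet> w} p \<partial>lborel)"
    by (intro nn_integral_mono_AE) (auto simp: mult.assoc intro: mult_left_mono elim!: eventually_mono)
  also have "\<dots> = (\<integral>\<^sup>+ m. \<integral>\<^sup>+ x. ennreal x * (?f (A + x *\<^sub>R (w + m *\<^sub>R w')) *
      indicator D (A + x *\<^sub>R (w + m *\<^sub>R w'))) * indicator {0<..} x \<partial>lborel \<partial>lborel)"
    by (rule nn_integral_fan_coordinates[OF w]) measurable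
  also have "\<dots> \<le> (\<integral>\<^sup>+ m. ennreal (1 / (1 + m\<^sup>2)) * indicator ?S m \<partial>lborel)"
  proof (rule nn_integral_mono)
    fix m :: real
    let ?q = "w + m *\<^sub>R w'"
    have slope: "m \<in> ?S" if "A + x *\<^sub>R ?q \<in> D" "0 < x" for x
    proof -
      have "x * (\<bar>m\<bar> * cos (\<alpha> / 2)) \<le> x * sin (\<alpha> / 2)"
        using D[OF that(1)] that(2) by (simp add: inner_add_left wn abs_mult)
      then show ?thesis using that(2) by simp
    qed
    have "(\<integral>\<^sup>+ x. ennreal x * (?f (A + x *\<^sub>R ?q) * indicator D (A + x *\<^sub>R ?q)) * indicator {0<..} x \<partial>lborel)
        \<le> (\<integral>\<^sup>+ x. indicator ?S m * (ennreal (x * disc_density c r R (A + x *\<^sub>R ?q)) * indicator {0<..} x) \<partial>lborel)"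
      using slope disc_density_nonneg[OF r]
      by (intro nn_integral_mono) (auto simp: indicator_def ennreal_mult')
    also have "\<dots> = indicator ?S m * (\<integral>\<^sup>+ x. ennreal (x * disc_density c r R (A + x *\<^sub>R ?q)) * indicator {0<..} x \<partial>lborel)"
      by (rule nn_integral_cmult) measurable
    also have "\<dots> \<le> indicator ?S m * ennreal (1 / (norm ?q)\<^sup>2)"
      using A by (intro mult_left_mono nn_integral_disc_density_ray_le r norm_orthonormal_direction[OF w])
                 (auto simp: dist_norm norm_minus_commute)
    finally show "(\<integral>\<^sup>+ x. ennreal x * (?f (A + x *\<^sub>R ?q) * indicator D (A + x *\<^sub>R ?q)) * indicator {0<..} x \<partial>lborel)
        \<le> ennreal (1 / (1 + m\<^sup>2)) * indicator ?S m"
      by (simp add: norm_orthonormal_direction[OF w] mult.commute)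
  qed
  also have "\<dots> \<le> ennreal \<alpha>" using \<alpha> by (rule nn_integral_arctan_kernel_fan_le)
  finally show ?thesis .
qed

text \<open>
  Seen from the point \<open>A = c - R *\<^sub>R w\<close> of the large circle, the open small disc is hit exactly by the
  rays whose slope is less than \<open>M = tan (arcsin (r / R))\<close> in absolute value, and each of them
  contributes the full angular element.
\<close>

lemma nn_integral_disc_density_ge:
  fixes c :: "real^2"
  assumes r: "0 < r" "r < R"
  shows "ennreal (2 * arcsin (r / R)) \<le> (\<integral>\<^sup>+ p. ennreal (disc_density c r R p) \<partial>lborel)"
proof -
  let ?f = "\<lambda>p. ennreal (disc_density c r R p)"
  have "norm (axis 1 1 :: real^2) = 1" by simp
  then obtain w w' :: "real^2" where w: "orthonormal_pair w w'" by (rule orthonormal_pair_exists)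
  note wn = orthonormal_pair_inner[OF w]
  define A where "A = c - R *\<^sub>R w"
  define M where "M = r / R / sqrt (1 - (r / R)\<^sup>2)"
  have rR: "0 < r / R" "r / R < 1" using r by auto
  have arc: "arcsin (r / R) = arctan M"
    unfolding M_def using rR by (intro arcsin_arctan) auto
  have R2: "0 < R\<^sup>2 - r\<^sup>2" using r by (simp add: power_strict_mono)
  have den: "1 - (r / R)\<^sup>2 = (R\<^sup>2 - r\<^sup>2) / R\<^sup>2"
    using r by (simp add: power_divide diff_divide_distrib)
  have M0: "0 \<le> M" unfolding M_def den using r R2 by simp
  have "(sqrt ((R\<^sup>2 - r\<^sup>2) / R\<^sup>2))\<^sup>2 = (R\<^sup>2 - r\<^sup>2) / R\<^sup>2"
    using R2 by (intro real_sqrt_pow2) simp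
  then have "M\<^sup>2 = r\<^sup>2 / R\<^sup>2 / ((R\<^sup>2 - r\<^sup>2) / R\<^sup>2)"
    unfolding M_def den by (simp only: power_divide)
  also have "\<dots> = r\<^sup>2 / (R\<^sup>2 - r\<^sup>2)"
    using r by (simp only: divide_divide_eq_right divide_divide_eq_left) simp
  finally have M2: "M\<^sup>2 * (R\<^sup>2 - r\<^sup>2) = r\<^sup>2"
    using R2 by simp
  have ray: "(\<integral>\<^sup>+ x. ennreal (x * disc_density c r R (A + x *\<^sub>R (w + m *\<^sub>R w'))) * indicator {0<..} x \<partial>lborel)
      = ennreal (1 / (1 + m\<^sup>2))" if "\<bar>m\<bar> < M" for m
  proof -
    let ?q = "w + m *\<^sub>R w'"
    note nq = norm_orthonormal_direction[OF w, of m]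
    have pq: "- ((A - c) \<bullet> ?q) / norm ?q = R / norm ?q"
      by (simp add: A_def inner_add_right wn)
    have nA: "norm (A - c) = R" using w r by (simp add: A_def orthonormal_pair_def)
    have "m\<^sup>2 < M\<^sup>2" using power_strict_mono[OF that, of 2] by simp
    then have "m\<^sup>2 * (R\<^sup>2 - r\<^sup>2) < M\<^sup>2 * (R\<^sup>2 - r\<^sup>2)" using R2 by simp
    then have "m\<^sup>2 * (R\<^sup>2 - r\<^sup>2) < r\<^sup>2" unfolding M2 .
    then have "R\<^sup>2 - (R / norm ?q)\<^sup>2 < r\<^sup>2"
    proof -
      have K: "0 < 1 + m\<^sup>2" by (simp add: add_pos_nonneg)
      then have "R\<^sup>2 - R\<^sup>2 / (1 + m\<^sup>2) = m\<^sup>2 * R\<^sup>2 / (1 + m\<^sup>2)"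
        by (simp add: divide_simps algebra_simps)
      also have "\<dots> < r\<^sup>2"
        using \<open>m\<^sup>2 * (R\<^sup>2 - r\<^sup>2) < r\<^sup>2\<close> by (simp add: pos_divide_less_eq[OF K] algebra_simps)
      finally show ?thesis unfolding power_divide nq(1) .
    qed
    then show ?thesis
      using nn_integral_disc_density_ray_eq[OF r nq(2), of A c] nA r unfolding pq nq(1) by simp
  qed
  have "ennreal (2 * arcsin (r / R)) = (\<integral>\<^sup>+ m. ennreal (1 / (1 + m\<^sup>2)) * indicator {-M..M} m \<partial>lborel)"
    unfolding arc using M0 by (rule nn_integral_arctan_kernel_Icc[symmetric])
  also have "\<dots> \<le> (\<integral>\<^sup>+ m. \<integral>\<^sup>+ x. ennreal x * ?f (A + x *\<^sub>R (w + m *\<^sub>R w')) * indicator {0<..} x \<partial>lborel \<partial>lborel)"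
  proof (rule nn_integral_mono_AE)
    have "AE m in lborel. m \<noteq> M" "AE m in lborel. m \<noteq> - M" by (rule AE_lborel_singleton)+
    then show "AE m in lborel. ennreal (1 / (1 + m\<^sup>2)) * indicator {-M..M} m
        \<le> (\<integral>\<^sup>+ x. ennreal x * ?f (A + x *\<^sub>R (w + m *\<^sub>R w')) * indicator {0<..} x \<partial>lborel)"
    proof eventually_elim
      case (elim m)
      show ?case
      proof (cases "m \<in> {-M..M}")
        case True
        then have "\<bar>m\<bar> < M" using elim by auto
        from ray[OF this, symmetric] have "ennreal (1 / (1 + m\<^sup>2))
            = (\<integral>\<^sup>+ x. ennreal (x * disc_density c r R (A + x *\<^sub>R (w + m *\<^sub>R w'))) * indicator {0<..} x \<partial>lborel)" .
        also have "\<dots> = (\<integral>\<^sup>+ x. ennreal x * ?f (A + x *\<^sub>R (w + m *\<^sub>R w')) * indicator {0<..} x \<partial>lborel)"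
          by (intro nn_integral_cong) (auto simp: indicator_def ennreal_mult' disc_density_nonneg[OF r])
        finally have "ennreal (1 / (1 + m\<^sup>2))
            = (\<integral>\<^sup>+ x. ennreal x * ?f (A + x *\<^sub>R (w + m *\<^sub>R w')) * indicator {0<..} x \<partial>lborel)" .
        then show ?thesis using True by simp
      qed simp
    qed
  qed
  also have "\<dots> = (\<integral>\<^sup>+ p. ?f p * indicator {p. 0 < (p - A) \<bullet> w} p \<partial>lborel)"
    by (rule nn_integral_fan_coordinates[OF w, symmetric]) measurable
  also have "\<dots> \<le> (\<integral>\<^sup>+ p. ?f p \<partial>lborel)"
    by (intro nn_integral_mono) (auto simp: indicator_def)
  finally show ?thesis .
qed

section \<open>Covering the disc\<close>

theorem theorem1:
  fixes c P :: "real^2" and r R :: real and m :: nat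
    and A :: "nat \<Rightarrow> real^2" and \<alpha> :: "nat \<Rightarrow> real" and D :: "nat \<Rightarrow> (real^2) set"
  assumes "0 < r" and "r < R"
    and "\<And>i. i \<in> {1..m} \<Longrightarrow> angular_domain (A i) (\<alpha> i) (D i)"
    and "\<And>i. i \<in> {1..m} \<Longrightarrow> A i \<in> cball c R"
    and "cball c r \<subseteq> (\<Union>i\<in>{1..m}. D i)"
    and "P \<in> sphere c R"
  shows "(\<Sum>i = 1..m. \<alpha> i) \<ge> view_angle c r P"
proof -
  let ?f = "\<lambda>p. ennreal (disc_density c r R p)"
  have D: "angular_domain (A i) (\<alpha> i) (D i)" "A i \<in> cball c R" if "i \<in> {1..m}" for i
    using assms(3,4) that by auto
  have D_borel [measurable]: "D i \<in> sets borel" if "i \<in> {1..m}" for i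
    using D(1)[OF that] by (auto simp: angular_domain_def)
  have \<alpha>: "0 \<le> \<alpha> i" and domain: "(\<integral>\<^sup>+ p. ?f p * indicator (D i) p \<partial>lborel) \<le> ennreal (\<alpha> i)"
    if i: "i \<in> {1..m}" for i
  proof -
    obtain w w' where w: "orthonormal_pair w w'" "0 \<le> \<alpha> i" "\<alpha> i \<le> pi"
      "\<forall>p\<in>D i. \<bar>(p - A i) \<bullet> w'\<bar> * cos (\<alpha> i / 2) \<le> ((p - A i) \<bullet> w) * sin (\<alpha> i / 2)"
      using angular_domain_subset_fan[OF D(1)[OF i]] by blast
    show "0 \<le> \<alpha> i" by (fact w(2))
    show "(\<integral>\<^sup>+ p. ?f p * indicator (D i) p \<partial>lborel) \<le> ennreal (\<alpha> i)"
      by (rule nn_integral_disc_density_fan_le[OF assms(1,2) D(2)[OF i] w(1) D_borel[OF i] w(2,3) bspec[OF w(4)]])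
  qed
  have "view_angle c r P = 2 * arcsin (r / R)"
    using view_angle_eq[of r P c] assms(1,2,6) by (simp add: dist_commute)
  then have "ennreal (view_angle c r P) \<le> (\<integral>\<^sup>+ p. ?f p \<partial>lborel)"
    using nn_integral_disc_density_ge[OF assms(1,2)] by simp
  also have "\<dots> \<le> (\<integral>\<^sup>+ p. (\<Sum>i = 1..m. ?f p * indicator (D i) p) \<partial>lborel)"
  proof (rule nn_integral_mono)
    fix p
    show "?f p \<le> (\<Sum>i = 1..m. ?f p * indicator (D i) p)"
    proof (cases "norm (p - c) < r")
      case True
      then have "p \<in> cball c r" by (simp add: dist_norm norm_minus_commute)
      then obtain i where i: "i \<in> {1..m}" "p \<in> D i" using assms(5) by blast
      then have "?f p = ?f p * indicator (D i) p" by simp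
      also have "\<dots> \<le> (\<Sum>i = 1..m. ?f p * indicator (D i) p)"
        using i(1) by (intro member_le_sum) auto
      finally show ?thesis .
    qed (simp add: disc_density_def)
  qed
  also have "\<dots> = (\<Sum>i = 1..m. \<integral>\<^sup>+ p. ?f p * indicator (D i) p \<partial>lborel)"
    by (intro nn_integral_sum) measurable
  also have "\<dots> \<le> (\<Sum>i = 1..m. ennreal (\<alpha> i))"
    by (intro sum_mono domain)
  also have "\<dots> = ennreal (\<Sum>i = 1..m. \<alpha> i)"
    using \<alpha> by (intro sum_ennreal)
  finally show ?thesis
    using \<alpha> by (subst (asm) ennreal_le_iff) (auto intro: sum_nonneg)
qed

end
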